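(* Let $S\subseteq\mathbb N^2$ be a symmetric (local) good semigroup with minimal nonzero element $\boldsymbol e=(e_1,e_2)$ and $\boldsymbol\gamma=(\gamma_1,\gamma_2)$. For an integer $n$ let $V(n)=\{(n,m)\in S: m\ge0\}$. Let $n\in\mathbb N$ and $n'=\gamma_1+e_1-n$. (1) $V(n)=\emptyset$ if and only if $V(n')$ is infinite and eventually contained in $\boldsymbol e+S$. (2) $V(n)$ is finite with maximal element in $\boldsymbol e+S$ if and only if $V(n')$ is finite with maximal element in $\boldsymbol e+S$. (3) $V(n)\nsubseteq\mathrm{Ap}(S)$ and $V(n)$ is finite with maximal element in $\mathrm{Ap}(S)$ if and only if $V(n')\nsubseteq\mathrm{Ap}(S)$ and $V(n')$ is finite with maximal element in $\mathrm{Ap}(S)$. (4) $V(n)\subseteq\mathrm{Ap}(S)$ and $V(n)$ is finite if and only if $V(n')$ is infinite and eventually contained in $\mathrm{Ap}(S)$ but contains some element of $\boldsymbol e+S$. (5) $V(n)\subseteq\mathrm{Ap}(S)$ and $V(n)$ is infinite if and only if $V(n')\subseteq\mathrm{Ap}(S)$ and $V(n')$ is infinite. All the corresponding statements hold for the second projection, i.e. with $V(n)$ replaced by $H(n)=\{(m,n)\in S:m\ge0\}$ and $n'$ replaced by $\gamma_2+e_2-n$.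
   Context: On $\mathbb Z^2$, $\le$ is the componentwise order and $\alpha\wedge\beta$ the componentwise minimum; $\mathbb N$ is the set of nonnegative integers. A good semigroup is a submonoid $S$ of $(\mathbb N^2,+)$ such that: (G1) $\alpha,\beta\in S\Rightarrow\alpha\wedge\beta\in S$; (G2) if $\alpha,\beta\in S$ and $\alpha_i=\beta_i$ for some $i\in\{1,2\}$, where $j$ is the other index, then there is $\delta\in S$ with $\delta_i>\alpha_i=\beta_i$, $\delta_j\ge\min\{\alpha_j,\beta_j\}$, and $\delta_j=\min\{\alpha_j,\beta_j\}$ if $\alpha_j\neq\beta_j$; (G3) there is $c\in S$ with $c+\mathbb N^2\subseteq S$. All good semigroups are assumed local: $(0,0)$ is the only element with a zero component. $\boldsymbol e=(e_1,e_2)$ is the minimum of $S\setminus\{(0,0)\}$, and $\mathrm{Ap}(S)=\{\alpha\in S:\alpha-\boldsymbol e\notin S\}=S\setminus(\boldsymbol e+S)$. The conductor is $\boldsymbol c=\min\{\alpha\in\mathbb Z^2:\alpha+\mathbb N^2\subseteq S\}$ and $\boldsymbol\gamma=\boldsymbol c-(1,1)$. For $\alpha\in\mathbb Z^2$, $\Delta^S(\alpha)$ is the set of $\beta\in S$ such that ($\beta_1=\alpha_1$ and $\beta_2>\alpha_2$) or ($\beta_2=\alpha_2$ and $\beta_1>\alpha_1$). $S$ is symmetric if for every $\alpha\in\mathbb N^2$: $\alpha\in S\iff\Delta^S(\boldsymbol\gamma-\alpha)=\emptyset$. Conventions: the set $V(n)$ (written $\Delta_1^S(n,0)$ in the paper)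 is either empty, finite or infinite, these being mutually exclusive; thus "finite" means nonempty and finite. "Eventually contained in $X$" means that all but finitely many of its elements belong to $X$. *)

theory Defs
  imports "HOL-Library.Product_Plus" "HOL-Library.Product_Order"
begin

text \<open>
  The lattice of integer points is the type \<^typ>\<open>int \<times> int\<close> with componentwise addition
  (Product_Plus) and componentwise order and infimum (Product_Order); the points of the natural
  quadrant are the \<open>\<alpha>\<close> with \<open>0 \<le> \<alpha>\<close>.
\<close>

definition good_semigroup :: "(int \<times> int) set \<Rightarrow> bool" where
  "good_semigroup S \<longleftrightarrow>
     (\<forall>\<alpha>\<in>S. 0 \<le> \<alpha>) \<and> 0 \<in> S \<and> (\<forall>\<alpha>\<in>S. \<forall>\<beta>\<in>S. \<alpha> + \<beta> \<in> S) \<and>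
     (\<forall>\<alpha>\<in>S. \<forall>\<beta>\<in>S. inf \<alpha> \<beta> \<in> S) \<and>
     (\<forall>(p, q) \<in> {(fst, snd), (snd, fst)}. \<forall>\<alpha>\<in>S. \<forall>\<beta>\<in>S. p \<alpha> = p \<beta> \<longrightarrow>
        (\<exists>\<delta>\<in>S. p \<delta> > p \<alpha> \<and> q \<delta> \<ge> min (q \<alpha>) (q \<beta>) \<and>
           (q \<alpha> \<noteq> q \<beta> \<longrightarrow> q \<delta> = min (q \<alpha>) (q \<beta>)))) \<and>
     (\<exists>c\<in>S. \<forall>\<beta>\<ge>0. c + \<beta> \<in> S)"

definition local_semigroup :: "(int \<times> int) set \<Rightarrow> bool" where
  "local_semigroup S \<longleftrightarrow> (\<forall>\<alpha>\<in>S. fst \<alpha> = 0 \<or> snd \<alpha> = 0 \<longrightarrow> \<alpha> = 0)"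

text \<open>
  In a local good semigroup both minima below exist: the componentwise infimum of finitely many
  elements of either set lies again in that set. Thus \<^const>\<open>Least\<close>, taken here with respect to
  a partial order, denotes the actual minimum.
\<close>

definition min_nonzero :: "(int \<times> int) set \<Rightarrow> int \<times> int" where
  "min_nonzero S = (LEAST \<alpha>. \<alpha> \<in> S - {0})"

definition conductor :: "(int \<times> int) set \<Rightarrow> int \<times> int" where
  "conductor S = (LEAST \<alpha>. \<forall>\<beta>\<ge>0. \<alpha> + \<beta> \<in> S)"

definition gam :: "(int \<times> int) set \<Rightarrow> int \<times> int" where
  "gam S = conductor S - (1, 1)"

definition eS :: "(int \<times> int) set \<Rightarrow> (int \<times> int) set" where
  "eS S = (\<lambda>\<alpha>. min_nonzero S + \<alpha>) ` S"

definition Ap :: "(int \<times> int) set \<Rightarrow> (int \<times> int) set" where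
  "Ap S = {\<alpha> \<in> S. \<alpha> - min_nonzero S \<notin> S}"

definition Delta :: "(int \<times> int) set \<Rightarrow> int \<times> int \<Rightarrow> (int \<times> int) set" where
  "Delta S \<alpha> = {\<beta> \<in> S. (fst \<beta> = fst \<alpha> \<and> snd \<beta> > snd \<alpha>) \<or> (snd \<beta> = snd \<alpha> \<and> fst \<beta> > fst \<alpha>)}"

definition symmetric_semigroup :: "(int \<times> int) set \<Rightarrow> bool" where
  "symmetric_semigroup S \<longleftrightarrow> (\<forall>\<alpha>\<ge>0. \<alpha> \<in> S \<longleftrightarrow> Delta S (gam S - \<alpha>) = {})"

definition V :: "(int \<times> int) set \<Rightarrow> int \<Rightarrow> (int \<times> int) set" where
  "V S n = {(n, m) | m. m \<ge> 0 \<and> (n, m) \<in> S}"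

definition H :: "(int \<times> int) set \<Rightarrow> int \<Rightarrow> (int \<times> int) set" where
  "H S n = {(m, n) | m. m \<ge> 0 \<and> (m, n) \<in> S}"

text \<open>The empty set does not count as finite in the classification of the fibres.\<close>

definition nonempty_finite :: "(int \<times> int) set \<Rightarrow> bool" where
  "nonempty_finite A \<longleftrightarrow> A \<noteq> {} \<and> finite A"

text \<open>Each fibre is a chain, so its maximal element is its greatest element.\<close>

definition finite_max_in :: "(int \<times> int) set \<Rightarrow> (int \<times> int) set \<Rightarrow> bool" where
  "finite_max_in A X \<longleftrightarrow> nonempty_finite A \<and> (\<exists>\<mu>\<in>A. (\<forall>\<alpha>\<in>A. \<alpha> \<le> \<mu>) \<and> \<mu> \<in> X)"

definition eventually_in :: "(int \<times> int) set \<Rightarrow> (int \<times> int) set \<Rightarrow> bool" where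
  "eventually_in A X \<longleftrightarrow> finite (A - X)"

end

theory Submission
  imports Defs
begin

text \<open>
  Symmetry gives a duality between the columns \<open>n\<close> and \<open>\<gamma>\<^sub>1 - n\<close>: one is empty iff the
  other is infinite, and if both are finite and nonempty, then their maxima add up to \<open>\<gamma>\<^sub>2\<close>. The part of column \<open>n\<close> inside \<open>e + S\<close> is a copy of column
  \<open>n - e\<^sub>1\<close>, shifted by \<open>e\<^sub>2\<close>. The substitution \<open>n' = \<gamma>\<^sub>1 + e\<^sub>1 - n\<close> makes \<open>n'\<close> dual to \<open>n - e\<^sub>1\<close>
  and \<open>n' - e\<^sub>1\<close> dual to \<open>n\<close>, so all five equivalences can be read off. Reflection in the diagonal
  transfers them to rows.
\<close>

section \<open>Minima of sets of lattice points\<close>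

lemma nonneg_int_function_has_minimum:
  fixes f :: "'a \<Rightarrow> int"
  assumes "A \<noteq> {}" and nonneg: "\<And>x. x \<in> A \<Longrightarrow> 0 \<le> f x"
  shows "\<exists>a\<in>A. \<forall>x\<in>A. f a \<le> f x"
proof -
  obtain b where "b \<in> A" using assms(1) by blast
  then obtain a where a: "a \<in> A" "\<forall>x. x \<in> A \<longrightarrow> nat (f a) \<le> nat (f x)"
    using ex_has_least_nat[of "\<lambda>x. x \<in> A" b "\<lambda>x. nat (f x)"] by blast
  have "f a \<le> f x" if "x \<in> A" for x
    using a(2) that nonneg[OF that] nat_le_eq_zle[of "f a" "f x"] nonneg[OF a(1)] by auto
  with a(1) show ?thesis by blast
qed

text \<open>Nonnegativity yields an element with least first coordinate and one with least second
  coordinate; their infimum lies below everything and stays in the set.\<close>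

lemma inf_closed_has_minimum:
  fixes A :: "(int \<times> int) set"
  assumes ne: "A \<noteq> {}" and nonneg: "\<And>\<alpha>. \<alpha> \<in> A \<Longrightarrow> 0 \<le> \<alpha>"
    and inf_closed: "\<And>\<alpha> \<beta>. \<alpha> \<in> A \<Longrightarrow> \<beta> \<in> A \<Longrightarrow> inf \<alpha> \<beta> \<in> A"
  shows "\<exists>\<mu>\<in>A. \<forall>\<alpha>\<in>A. \<mu> \<le> \<alpha>"
proof -
  have "0 \<le> fst \<alpha>" "0 \<le> snd \<alpha>" if "\<alpha> \<in> A" for \<alpha>
    using nonneg[OF that] by (simp_all add: less_eq_prod_def)
  then obtain \<alpha> \<beta> where \<alpha>: "\<alpha> \<in> A" "\<forall>\<delta>\<in>A. fst \<alpha> \<le> fst \<delta>"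
    and \<beta>: "\<beta> \<in> A" "\<forall>\<delta>\<in>A. snd \<beta> \<le> snd \<delta>"
    using nonneg_int_function_has_minimum[of A fst] nonneg_int_function_has_minimum[of A snd] ne
    by metis
  have "\<forall>\<delta>\<in>A. inf \<alpha> \<beta> \<le> \<delta>"
    using \<alpha>(2) \<beta>(2) by (auto simp: less_eq_prod_def le_infI1 le_infI2)
  then show ?thesis using inf_closed[OF \<alpha>(1) \<beta>(1)] by blast
qed

section \<open>Symmetric local good semigroups\<close>

locale symmetric_local_good_semigroup =
  fixes S :: "(int \<times> int) set"
  assumes good: "good_semigroup S"
    and local: "local_semigroup S"
    and symmetric: "symmetric_semigroup S"
begin

section \<open>The semigroup axioms and the existence of the two minima\<close>

lemma nonneg: "\<alpha> \<in> S \<Longrightarrow> 0 \<le> \<alpha>"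
  and add_mem: "\<alpha> \<in> S \<Longrightarrow> \<beta> \<in> S \<Longrightarrow> \<alpha> + \<beta> \<in> S"
  and inf_mem: "\<alpha> \<in> S \<Longrightarrow> \<beta> \<in> S \<Longrightarrow> inf \<alpha> \<beta> \<in> S"
  and conductor_exists: "\<exists>c\<in>S. \<forall>\<beta>\<ge>0. c + \<beta> \<in> S"
proof -
  have S: "\<forall>\<alpha>\<in>S. 0 \<le> \<alpha>" "\<forall>\<alpha>\<in>S. \<forall>\<beta>\<in>S. \<alpha> + \<beta> \<in> S" "\<forall>\<alpha>\<in>S. \<forall>\<beta>\<in>S. inf \<alpha> \<beta> \<in> S"
    "\<exists>c\<in>S. \<forall>\<beta>\<ge>0. c + \<beta> \<in> S"
    using good unfolding good_semigroup_def by - (elim conjE, assumption)+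
  then show "\<alpha> \<in> S \<Longrightarrow> 0 \<le> \<alpha>" "\<alpha> \<in> S \<Longrightarrow> \<beta> \<in> S \<Longrightarrow> \<alpha> + \<beta> \<in> S"
    "\<alpha> \<in> S \<Longrightarrow> \<beta> \<in> S \<Longrightarrow> inf \<alpha> \<beta> \<in> S" by simp_all
  show "\<exists>c\<in>S. \<forall>\<beta>\<ge>0. c + \<beta> \<in> S" by (rule S(4))
qed

lemma nonneg_pair: "(a, b) \<in> S \<Longrightarrow> 0 \<le> a \<and> 0 \<le> b"
  using nonneg[of "(a, b)"] by (simp add: less_eq_prod_def)

text \<open>Axiom (G2) for two points of equal height: the new point is strictly higher, and its
  first coordinate is the smaller one, so it stays in the left column.\<close>

lemma same_snd_extend:
  assumes "(a, b) \<in> S" "(a', b) \<in> S" "a < a'"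
  shows "\<exists>b'>b. (a, b') \<in> S"
proof -
  have "\<forall>\<alpha>\<in>S. \<forall>\<beta>\<in>S. snd \<alpha> = snd \<beta> \<longrightarrow>
        (\<exists>\<delta>\<in>S. snd \<delta> > snd \<alpha> \<and> fst \<delta> \<ge> min (fst \<alpha>) (fst \<beta>) \<and>
           (fst \<alpha> \<noteq> fst \<beta> \<longrightarrow> fst \<delta> = min (fst \<alpha>) (fst \<beta>)))"
    using good unfolding good_semigroup_def by simp
  from this[rule_format, OF assms(1,2)] assms(3) show ?thesis
    by (auto simp: min_def)
qed

text \<open>Locality is what keeps \<open>S - {0}\<close> closed under infima: nonzero elements have
  nonzero first coordinates, hence so has their infimum. \<open>Least\<close> is then a true
  minimum.\<close>

lemma min_nonzero_mem: "min_nonzero S \<in> S - {0}"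
  and min_nonzero_le: "\<alpha> \<in> S - {0} \<Longrightarrow> min_nonzero S \<le> \<alpha>"
proof -
  obtain c where c: "c \<in> S" "\<forall>\<beta>\<ge>0. c + \<beta> \<in> S" using conductor_exists by blast
  have "c + (1, 1) \<in> S" using c(2) by (simp add: less_eq_prod_def)
  moreover have "c + (1, 1) \<noteq> 0"
    using nonneg[OF c(1)] by (auto simp: prod_eq_iff less_eq_prod_def)
  ultimately have "S - {0} \<noteq> {}" by blast
  moreover have "inf \<alpha> \<beta> \<in> S - {0}" if "\<alpha> \<in> S - {0}" "\<beta> \<in> S - {0}" for \<alpha> \<beta>
  proof -
    have "fst (inf \<alpha> \<beta>) \<noteq> 0"
      using that local unfolding local_semigroup_def by (auto simp: inf_int_def min_def)
    then have "inf \<alpha> \<beta> \<noteq> 0" by (metis fst_zero)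
    then show ?thesis using that inf_mem by blast
  qed
  ultimately have "\<exists>\<mu>\<in>S - {0}. \<forall>\<alpha>\<in>S - {0}. \<mu> \<le> \<alpha>"
    using nonneg by (intro inf_closed_has_minimum) auto
  then obtain \<mu> where \<mu>: "\<mu> \<in> S - {0}" "\<forall>\<alpha>\<in>S - {0}. \<mu> \<le> \<alpha>" by blast
  then have "min_nonzero S = \<mu>"
    unfolding min_nonzero_def by (intro Least_equality) blast+
  with \<mu> show "min_nonzero S \<in> S - {0}" "\<alpha> \<in> S - {0} \<Longrightarrow> min_nonzero S \<le> \<alpha>" by blast+
qed

text \<open>The points \<open>\<alpha>\<close> whose whole upper quadrant lies in \<open>S\<close>
  are closed under infima. By distributivity, any \<open>p\<close> above
  \<open>inf \<alpha> \<alpha>'\<close> equals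
  \<open>inf (sup p \<alpha>) (sup p \<alpha>')\<close>, and both suprema lie in
  \<open>S\<close>.\<close>

lemma conductor_add_mem: "0 \<le> \<beta> \<Longrightarrow> conductor S + \<beta> \<in> S"
  and conductor_le: "(\<And>\<beta>. 0 \<le> \<beta> \<Longrightarrow> \<alpha> + \<beta> \<in> S) \<Longrightarrow> conductor S \<le> \<alpha>"
proof -
  let ?C = "{\<alpha>. \<forall>\<beta>\<ge>0. \<alpha> + \<beta> \<in> S}"
  have "?C \<noteq> {}" using conductor_exists by blast
  moreover have "0 \<le> \<alpha>" if "\<alpha> \<in> ?C" for \<alpha>
    using that[THEN CollectD, rule_format, of 0] nonneg by simp
  moreover have "inf \<alpha> \<alpha>' \<in> ?C" if "\<alpha> \<in> ?C" "\<alpha>' \<in> ?C" for \<alpha> \<alpha>'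
  proof (intro CollectI allI impI)
    fix \<beta> :: "int \<times> int" assume "0 \<le> \<beta>"
    define p where "p = inf \<alpha> \<alpha>' + \<beta>"
    have "sup p x \<in> S" if "x \<in> ?C" for x
    proof -
      have "0 \<le> sup p x - x" by (simp add: less_eq_prod_def)
      with that have "x + (sup p x - x) \<in> S" by blast
      then show ?thesis by simp
    qed
    with that have "inf (sup p \<alpha>) (sup p \<alpha>') \<in> S" by (simp add: inf_mem)
    moreover have "inf (sup p \<alpha>) (sup p \<alpha>') = p"
      using \<open>0 \<le> \<beta>\<close> unfolding p_def
      by (auto simp: prod_eq_iff less_eq_prod_def inf_int_def sup_int_def)
    ultimately show "inf \<alpha> \<alpha>' + \<beta> \<in> S" unfolding p_def by simp
  qed
  ultimately have "\<exists>\<mu>\<in>?C. \<forall>\<alpha>\<in>?C. \<mu> \<le> \<alpha>"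
    by (rule inf_closed_has_minimum)
  then obtain \<mu> where \<mu>: "\<mu> \<in> ?C" "\<forall>\<alpha>\<in>?C. \<mu> \<le> \<alpha>" by blast
  then have "conductor S = \<mu>"
    unfolding conductor_def by (intro Least_equality) blast+
  with \<mu> show "0 \<le> \<beta> \<Longrightarrow> conductor S + \<beta> \<in> S"
    "(\<And>\<beta>. 0 \<le> \<beta> \<Longrightarrow> \<alpha> + \<beta> \<in> S) \<Longrightarrow> conductor S \<le> \<alpha>" by blast+
qed

section \<open>Symmetry on the whole lattice\<close>

lemma above_gam_mem:
  assumes "fst (gam S) < a" "snd (gam S) < b"
  shows "(a, b) \<in> S"
proof -
  have "0 \<le> (a, b) - conductor S"
    using assms by (simp add: gam_def less_eq_prod_def)
  from conductor_add_mem[OF this] show ?thesis by simp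
qed

text \<open>Extends symmetry to points with a negative coordinate. These lie outside
  \<open>S\<close>, and one arm of the corresponding \<open>Delta\<close> runs beyond the conductor,
  so it is not empty.\<close>

lemma mem_iff_Delta_empty: "(a, b) \<in> S \<longleftrightarrow> Delta S (gam S - (a, b)) = {}"
proof (cases "0 \<le> a \<and> 0 \<le> b")
  case True
  then show ?thesis
    using symmetric unfolding symmetric_semigroup_def by (simp add: less_eq_prod_def)
next
  case False
  then consider "a < 0" | "b < 0" by linarith
  then have "Delta S (gam S - (a, b)) \<noteq> {}"
  proof cases
    case 1
    \<comment> \<open>The summand \<open>\<bar>b\<bar> + 1\<close> puts the height above both
      \<open>\<gamma>\<^sub>2\<close>, for membership in \<open>S\<close>, and
      \<open>\<gamma>\<^sub>2 - b\<close>, for membership in \<open>Delta\<close>.\<close>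
    then have "(fst (gam S) - a, snd (gam S) + \<bar>b\<bar> + 1) \<in> S" by (intro above_gam_mem) auto
    then have "(fst (gam S) - a, snd (gam S) + \<bar>b\<bar> + 1) \<in> Delta S (gam S - (a, b))"
      by (auto simp: Delta_def)
    then show ?thesis by blast
  next
    case 2
    then have "(fst (gam S) + \<bar>a\<bar> + 1, snd (gam S) - b) \<in> S" by (intro above_gam_mem) auto
    then have "(fst (gam S) + \<bar>a\<bar> + 1, snd (gam S) - b) \<in> Delta S (gam S - (a, b))"
      by (auto simp: Delta_def)
    then show ?thesis by blast
  qed
  with False show ?thesis using nonneg_pair by blast
qed

section \<open>Duality of columns\<close>

text \<open>Fibres are reduced to sets of integers so that \<open>Max\<close> can be applied to
  them.\<close>

definition col :: "int \<Rightarrow> int set" where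
  "col n = {m. (n, m) \<in> S}"

lemma col_iff: "m \<in> col n \<longleftrightarrow> (n, m) \<in> S"
  by (simp add: col_def)

text \<open>The two conjuncts express emptiness of the vertical and the horizontal arm of
  \<open>Delta S (gam S - (n, m))\<close>.\<close>

lemma col_dual:
  "m \<in> col n \<longleftrightarrow>
     (\<forall>k\<in>col (fst (gam S) - n). k \<le> snd (gam S) - m) \<and>
     (\<forall>x>fst (gam S) - n. snd (gam S) - m \<notin> col x)"
proof -
  have "Delta S (gam S - (n, m)) = {} \<longleftrightarrow>
      (\<forall>k\<in>col (fst (gam S) - n). \<not> k > snd (gam S) - m) \<and>
      (\<forall>x>fst (gam S) - n. snd (gam S) - m \<notin> col x)"
    unfolding Delta_def col_def by auto
  then show ?thesis unfolding col_iff[of m n] mem_iff_Delta_empty[of n m] not_less .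
qed

lemma col_unbounded:
  assumes "infinite (col n)"
  shows "\<exists>m\<in>col n. b < m"
proof (rule ccontr)
  assume "\<not> ?thesis"
  then have "col n \<subseteq> {0..b}" using nonneg_pair by (force simp: col_def)
  then show False using assms finite_subset by blast
qed

text \<open>The vertical arm is empty by assumption; a point on the horizontal arm would have
  negative height \<open>\<gamma>\<^sub>2 - m\<close>.\<close>

lemma col_full:
  assumes "col (fst (gam S) - n) = {}" and "snd (gam S) < m"
  shows "m \<in> col n"
proof -
  have "snd (gam S) - m \<notin> col x" for x
  proof
    assume "snd (gam S) - m \<in> col x"
    then have "0 \<le> snd (gam S) - m" using nonneg_pair unfolding col_iff by blast
    with assms(2) show False by simp
  qed
  then show ?thesis unfolding col_dual[of m n] assms(1) by simp
qed

text \<open>Each \<open>m\<close> in column \<open>n\<close> bounds the dual column by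
  \<open>\<gamma>\<^sub>2 - m\<close>, so arbitrarily large \<open>m\<close> leave no room for an
  element there. Conversely, an empty dual column puts a full ray into column
  \<open>n\<close>.\<close>

lemma infinite_col_iff: "infinite (col n) \<longleftrightarrow> col (fst (gam S) - n) = {}"
proof
  assume inf: "infinite (col n)"
  have False if k: "k \<in> col (fst (gam S) - n)" for k
  proof -
    obtain m where "m \<in> col n" "snd (gam S) - k < m" using col_unbounded[OF inf] by blast
    moreover from this(1) have "k \<le> snd (gam S) - m" using k col_dual[of m n] by blast
    ultimately show False by linarith
  qed
  then show "col (fst (gam S) - n) = {}" by blast
next
  assume "col (fst (gam S) - n) = {}"
  then have "{snd (gam S)<..} \<subseteq> col n" using col_full by auto
  then show "infinite (col n)" using infinite_Ioi finite_subset by blast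
qed

text \<open>The vertical arm at the top of column \<open>n\<close> bounds the sum by
  \<open>\<gamma>\<^sub>2\<close>. For the reverse inequality, the height
  \<open>\<gamma>\<^sub>2 - Max (col ?d)\<close> is shown to occur in column
  \<open>n\<close>.\<close>

lemma Max_col_add:
  assumes n: "finite (col n)" "col n \<noteq> {}"
  shows "Max (col n) + Max (col (fst (gam S) - n)) = snd (gam S)"
proof -
  let ?d = "fst (gam S) - n"
  have d: "finite (col ?d)" "col ?d \<noteq> {}"
    using n infinite_col_iff[of n] infinite_col_iff[of ?d] unfolding diff_diff_eq2 add_diff_cancel_left'
    by blast+
  have "Max (col ?d) \<le> snd (gam S) - Max (col n)"
    using col_dual[of "Max (col n)" n] Max_in[OF n] Max_in[OF d] by blast
  moreover have "snd (gam S) - Max (col ?d) \<in> col n"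
  proof -
    \<comment> \<open>The horizontal arm is empty: a point to the right of the top of column
      \<open>?d\<close>, at the same height, would by (G2) force a higher point in column
      \<open>?d\<close>.\<close>
    have "Max (col ?d) \<notin> col x" if x: "x > ?d" for x
    proof
      assume "Max (col ?d) \<in> col x"
      then obtain b where "b > Max (col ?d)" "b \<in> col ?d"
        using same_snd_extend[of ?d "Max (col ?d)" x, folded col_iff] Max_in[OF d] x by blast
      then show False using Max_ge[OF d(1), of b] by simp
    qed
    then show ?thesis
      using Max_ge[OF d(1)] col_dual[of "snd (gam S) - Max (col ?d)" n] by simp
  qed
  then have "snd (gam S) - Max (col ?d) \<le> Max (col n)" using n by simp
  ultimately show ?thesis by linarith
qed

section \<open>Fibres, \<open>e + S\<close> and the Apery set in terms of columns\<close>

lemma V_eq: "V S n = Pair n ` col n"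
  using nonneg_pair by (auto simp: V_def col_def)

lemma V_empty_iff: "V S n = {} \<longleftrightarrow> col n = {}"
  by (simp add: V_eq)

lemma finite_V_iff: "finite (V S n) \<longleftrightarrow> finite (col n)"
  by (simp add: V_eq finite_image_iff inj_on_def)

lemma mem_eS_iff: "(n, m) \<in> eS S \<longleftrightarrow> m - snd (min_nonzero S) \<in> col (n - fst (min_nonzero S))"
proof -
  have "\<alpha> \<in> eS S \<longleftrightarrow> \<alpha> - min_nonzero S \<in> S" for \<alpha>
    unfolding eS_def by (force simp: image_iff algebra_simps)
  then show ?thesis by (simp add: col_def minus_prod_def)
qed

lemma mem_Ap_iff: "(n, m) \<in> Ap S \<longleftrightarrow> m \<in> col n \<and> (n, m) \<notin> eS S"
  unfolding mem_eS_iff by (simp add: Ap_def col_def minus_prod_def)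

lemma eS_subset: "eS S \<subseteq> S"
  unfolding eS_def using min_nonzero_mem add_mem by blast

lemma V_inter_eS:
  "V S n \<inter> eS S = (\<lambda>m. (n, m + snd (min_nonzero S))) ` col (n - fst (min_nonzero S))"
proof -
  have "V S n \<inter> eS S = Pair n ` {m. (n, m) \<in> eS S}"
    unfolding V_eq using eS_subset by (auto simp: col_def)
  also have "\<dots> = (\<lambda>m. (n, m + snd (min_nonzero S))) ` col (n - fst (min_nonzero S))"
    unfolding mem_eS_iff by (force simp: image_iff)
  finally show ?thesis .
qed

lemma V_inter_eS_empty_iff: "V S n \<inter> eS S = {} \<longleftrightarrow> col (n - fst (min_nonzero S)) = {}"
  by (simp add: V_inter_eS)

lemma finite_V_inter_eS_iff:
  "finite (V S n \<inter> eS S) \<longleftrightarrow> finite (col (n - fst (min_nonzero S)))"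
  by (simp add: V_inter_eS finite_image_iff inj_on_def)

text \<open>\<open>Ap S\<close> and \<open>eS S\<close> partition \<open>S\<close>, so the
  conditions on \<open>Ap S\<close> become conditions on the shifted column
  \<open>n - e\<^sub>1\<close>.\<close>

lemma V_diff_Ap: "V S n - Ap S = V S n \<inter> eS S"
  by (auto simp: V_eq mem_Ap_iff)

lemma V_subset_Ap_iff: "V S n \<subseteq> Ap S \<longleftrightarrow> col (n - fst (min_nonzero S)) = {}"
  using V_diff_Ap[of n] V_inter_eS_empty_iff[of n] by blast

lemma V_eventually_in_Ap_iff:
  "eventually_in (V S n) (Ap S) \<longleftrightarrow> finite (col (n - fst (min_nonzero S)))"
  by (simp add: eventually_in_def V_diff_Ap finite_V_inter_eS_iff)

text \<open>If the fibre is infinite and only finitely many elements miss \<open>e + S\<close>, the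
  part inside is infinite. Conversely, an infinite shifted column contains every height above
  \<open>\<gamma>\<^sub>2\<close>, which confines the exceptions to a bounded range.\<close>

lemma infinite_V_eventually_in_eS_iff:
  "infinite (V S n) \<and> eventually_in (V S n) (eS S) \<longleftrightarrow>
     infinite (col (n - fst (min_nonzero S)))"
proof
  assume "infinite (V S n) \<and> eventually_in (V S n) (eS S)"
  then have "infinite (V S n \<inter> eS S)"
    unfolding eventually_in_def by (metis Int_Diff_Un finite_Un)
  then show "infinite (col (n - fst (min_nonzero S)))" by (simp add: finite_V_inter_eS_iff)
next
  let ?k = "n - fst (min_nonzero S)"
  assume inf: "infinite (col ?k)"
  then have "infinite (V S n)" using finite_V_inter_eS_iff by blast
  \<comment> \<open>Heights \<open>m\<close> beyond this bound satisfy
    \<open>m - e\<^sub>2 > \<gamma>\<^sub>2\<close>, hence belong to the shifted copy.\<close>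
  moreover have "V S n - eS S \<subseteq> Pair n ` {0..snd (gam S) + snd (min_nonzero S)}"
  proof
    fix \<alpha> assume \<alpha>: "\<alpha> \<in> V S n - eS S"
    then obtain m where m: "\<alpha> = (n, m)" "m \<in> col n" by (auto simp: V_eq)
    then have "m - snd (min_nonzero S) \<notin> col ?k" using \<alpha> by (simp add: mem_eS_iff)
    then have "\<not> snd (gam S) < m - snd (min_nonzero S)"
      using col_full inf[unfolded infinite_col_iff] by blast
    moreover have "0 \<le> m" using m(2) nonneg_pair by (simp add: col_iff)
    ultimately show "\<alpha> \<in> Pair n ` {0..snd (gam S) + snd (min_nonzero S)}" using m(1) by simp
  qed
  then have "finite (V S n - eS S)" using finite_subset by blast
  ultimately show "infinite (V S n) \<and> eventually_in (V S n) (eS S)"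
    by (simp add: eventually_in_def)
qed

text \<open>Within one column the componentwise order is the order of heights, so the greatest
  element is the point of height \<open>Max (col n)\<close>.\<close>

lemma finite_max_in_V_iff:
  "finite_max_in (V S n) X \<longleftrightarrow> finite (col n) \<and> col n \<noteq> {} \<and> (n, Max (col n)) \<in> X"
proof -
  have "(\<exists>\<mu>\<in>V S n. (\<forall>\<alpha>\<in>V S n. \<alpha> \<le> \<mu>) \<and> \<mu> \<in> X) \<longleftrightarrow> (n, Max (col n)) \<in> X"
    if fin: "finite (col n)" "col n \<noteq> {}"
  proof -
    have "(\<exists>\<mu>\<in>V S n. (\<forall>\<alpha>\<in>V S n. \<alpha> \<le> \<mu>) \<and> \<mu> \<in> X) \<longleftrightarrow>
        (\<exists>m\<in>col n. (\<forall>k\<in>col n. k \<le> m) \<and> (n, m) \<in> X)"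
      by (simp add: V_eq)
    also have "\<dots> \<longleftrightarrow> (n, Max (col n)) \<in> X"
      using fin Max_in[OF fin] Max_ge[OF fin(1)] Max_eqI[OF fin(1)] by metis
    finally show ?thesis .
  qed
  then show ?thesis
    unfolding finite_max_in_def nonempty_finite_def finite_V_iff V_empty_iff by blast
qed

text \<open>Turns membership into an equation between maxima, on which duality can act. The top of
  the shifted column plus \<open>e\<close> always lies in column \<open>n\<close>; the two tops
  coincide exactly when that of column \<open>n\<close> comes from the shifted copy.\<close>

lemma Max_col_mem_eS_iff:
  assumes n: "finite (col n)"
    and k: "finite (col (n - fst (min_nonzero S)))" "col (n - fst (min_nonzero S)) \<noteq> {}"
  shows "(n, Max (col n)) \<in> eS S \<longleftrightarrow>
    Max (col n) = Max (col (n - fst (min_nonzero S))) + snd (min_nonzero S)"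
proof
  let ?k = "n - fst (min_nonzero S)" and ?e = "snd (min_nonzero S)"
  have "Max (col ?k) + ?e \<in> col n"
    using mem_eS_iff[of n "Max (col ?k) + ?e"] Max_in[OF k] eS_subset by (auto simp: col_def)
  then have "Max (col ?k) + ?e \<le> Max (col n)" using n by simp
  moreover assume "(n, Max (col n)) \<in> eS S"
  then have "Max (col n) - ?e \<le> Max (col ?k)"
    using k by (simp add: mem_eS_iff)
  ultimately show "Max (col n) = Max (col ?k) + ?e" by linarith
next
  assume "Max (col n) = Max (col (n - fst (min_nonzero S))) + snd (min_nonzero S)"
  then show "(n, Max (col n)) \<in> eS S" using Max_in[OF k] by (simp add: mem_eS_iff)
qed

section \<open>The dual pairs \<open>n\<close>, \<open>n' - e\<^sub>1\<close> and \<open>n'\<close>,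
  \<open>n - e\<^sub>1\<close>, and the classification\<close>

lemma column_duality:
  fixes n :: int
  defines "e1 \<equiv> fst (min_nonzero S)"
  defines "n' \<equiv> fst (gam S) + e1 - n"
  shows "infinite (col n') \<longleftrightarrow> col (n - e1) = {}" and "infinite (col (n' - e1)) \<longleftrightarrow> col n = {}"
    and "infinite (col n) \<longleftrightarrow> col (n' - e1) = {}" and "infinite (col (n - e1)) \<longleftrightarrow> col n' = {}"
proof -
  have "fst (gam S) - n' = n - e1" "fst (gam S) - (n' - e1) = n"
    "fst (gam S) - n = n' - e1" "fst (gam S) - (n - e1) = n'"
    by (simp_all add: n'_def)
  then show "infinite (col n') \<longleftrightarrow> col (n - e1) = {}" "infinite (col (n' - e1)) \<longleftrightarrow> col n = {}"
    "infinite (col n) \<longleftrightarrow> col (n' - e1) = {}" "infinite (col (n - e1)) \<longleftrightarrow> col n' = {}"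
    by (simp_all only: infinite_col_iff)
qed

text \<open>The maxima of each dual pair add up to \<open>\<gamma>\<^sub>2\<close>, so the gap
  between the tops of columns \<open>n\<close> and \<open>n - e\<^sub>1\<close> equals the gap for
  \<open>n'\<close> and \<open>n' - e\<^sub>1\<close>. One gap is \<open>e\<^sub>2\<close> iff the
  other is.\<close>

lemma Max_col_mem_eS_dual:
  fixes n :: int
  defines "e1 \<equiv> fst (min_nonzero S)"
  defines "n' \<equiv> fst (gam S) + e1 - n"
  assumes fin: "finite (col n)" "col n \<noteq> {}" "finite (col (n - e1))" "col (n - e1) \<noteq> {}"
  shows "(n, Max (col n)) \<in> eS S \<longleftrightarrow> (n', Max (col n')) \<in> eS S"
proof -
  have fin': "finite (col n')" "finite (col (n' - e1))" "col (n' - e1) \<noteq> {}"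
    using fin column_duality[of n, folded e1_def, folded n'_def] by blast+
  have "Max (col n) + Max (col (n' - e1)) = snd (gam S)"
    using Max_col_add[OF fin(1,2)] by (simp add: n'_def)
  moreover have "fst (gam S) - (n - e1) = n'" by (simp add: n'_def)
  then have "Max (col (n - e1)) + Max (col n') = snd (gam S)"
    using Max_col_add[OF fin(3,4)] by simp
  ultimately have "Max (col n) = Max (col (n - e1)) + snd (min_nonzero S) \<longleftrightarrow>
      Max (col n') = Max (col (n' - e1)) + snd (min_nonzero S)"
    by linarith
  then show ?thesis
    unfolding Max_col_mem_eS_iff[OF fin(1) fin(3,4)[unfolded e1_def]]
      Max_col_mem_eS_iff[OF fin'(1) fin'(2,3)[unfolded e1_def]] e1_def .
qed

theorem column_classification:
  fixes n :: int
  defines "n' \<equiv> fst (gam S) + fst (min_nonzero S) - n"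
  shows
    "(V S n = {} \<longleftrightarrow> infinite (V S n') \<and> eventually_in (V S n') (eS S)) \<and>
     (finite_max_in (V S n) (eS S) \<longleftrightarrow> finite_max_in (V S n') (eS S)) \<and>
     (\<not> V S n \<subseteq> Ap S \<and> finite_max_in (V S n) (Ap S) \<longleftrightarrow>
        \<not> V S n' \<subseteq> Ap S \<and> finite_max_in (V S n') (Ap S)) \<and>
     (V S n \<subseteq> Ap S \<and> nonempty_finite (V S n) \<longleftrightarrow>
        infinite (V S n') \<and> eventually_in (V S n') (Ap S) \<and> V S n' \<inter> eS S \<noteq> {}) \<and>
     (V S n \<subseteq> Ap S \<and> infinite (V S n) \<longleftrightarrow> V S n' \<subseteq> Ap S \<and> infinite (V S n'))"
proof -
  note dual = column_duality[of n, folded n'_def]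
  note maxdual = Max_col_mem_eS_dual[of n, folded n'_def]
  have Max_Ap: "(x, Max (col x)) \<in> Ap S \<longleftrightarrow> (x, Max (col x)) \<notin> eS S"
    if "finite (col x)" "col x \<noteq> {}" for x
    using Max_in[OF that] by (simp add: mem_Ap_iff)
  have shifted_nonempty: "col (x - fst (min_nonzero S)) \<noteq> {}" if "(x, Max (col x)) \<in> eS S" for x
    using that by (auto simp: mem_eS_iff)
  \<comment> \<open>The shifted column embeds into column \<open>x\<close> by adding
    \<open>e\<close>.\<close>
  have shifted_finite: "finite (col (x - fst (min_nonzero S)))" if "finite (col x)" for x
    using that finite_V_inter_eS_iff[of x] by (simp add: finite_V_iff)
  \<comment> \<open>A top in \<open>e + S\<close> makes the shifted column nonempty, so all four
    columns are finite and nonempty and the comparison of maxima applies.\<close>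
  have 2: "finite_max_in (V S n) (eS S) \<longleftrightarrow> finite_max_in (V S n') (eS S)"
    unfolding finite_max_in_V_iff
    using dual maxdual shifted_nonempty[of n] shifted_nonempty[of n']
      shifted_finite[of n] shifted_finite[of n'] by argo
  \<comment> \<open>Here the top lies outside \<open>e + S\<close>; nonemptiness of the shifted
    column comes from the failure of inclusion in \<open>Ap S\<close>.\<close>
  have 3: "\<not> V S n \<subseteq> Ap S \<and> finite_max_in (V S n) (Ap S) \<longleftrightarrow>
        \<not> V S n' \<subseteq> Ap S \<and> finite_max_in (V S n') (Ap S)"
    unfolding finite_max_in_V_iff V_subset_Ap_iff
    using dual maxdual Max_Ap[of n] Max_Ap[of n'] shifted_finite[of n] shifted_finite[of n']
    by argo
  show ?thesis
  proof (intro conjI)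
    show "V S n = {} \<longleftrightarrow> infinite (V S n') \<and> eventually_in (V S n') (eS S)"
      unfolding infinite_V_eventually_in_eS_iff V_empty_iff using dual by blast
    \<comment> \<open>The conditions match one by one: inclusion in \<open>Ap S\<close> with
      infinitude of \<open>V S n'\<close>, nonemptiness with eventual containment, finiteness with
      meeting \<open>e + S\<close>.\<close>
    show "V S n \<subseteq> Ap S \<and> nonempty_finite (V S n) \<longleftrightarrow>
        infinite (V S n') \<and> eventually_in (V S n') (Ap S) \<and> V S n' \<inter> eS S \<noteq> {}"
      unfolding V_subset_Ap_iff V_eventually_in_Ap_iff V_inter_eS_empty_iff
        nonempty_finite_def finite_V_iff V_empty_iff using dual by blast
    \<comment> \<open>Duality interchanges the two conjuncts: inclusion for \<open>n\<close> is
      infinitude for \<open>n'\<close>, and vice versa.\<close>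
    show "V S n \<subseteq> Ap S \<and> infinite (V S n) \<longleftrightarrow> V S n' \<subseteq> Ap S \<and> infinite (V S n')"
      unfolding V_subset_Ap_iff finite_V_iff using dual by blast
  qed (rule 2 | rule 3)+
qed

end

section \<open>Reflection in the diagonal\<close>

lemma mem_swap_image_iff: "\<alpha> \<in> prod.swap ` A \<longleftrightarrow> prod.swap \<alpha> \<in> A"
  by (cases \<alpha>) simp

lemma swap_le_swap_iff: "prod.swap \<alpha> \<le> prod.swap \<beta> \<longleftrightarrow> \<alpha> \<le> (\<beta> :: int \<times> int)"
  by (auto simp: less_eq_prod_def)

lemma zero_le_swap_iff: "0 \<le> prod.swap \<alpha> \<longleftrightarrow> 0 \<le> (\<alpha> :: int \<times> int)"
  by (auto simp: less_eq_prod_def)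

lemma swap_add: "prod.swap (\<alpha> + \<beta>) = prod.swap \<alpha> + prod.swap \<beta>"
  and swap_diff: "prod.swap (\<alpha>' - \<beta>') = prod.swap \<alpha>' - prod.swap \<beta>'"
  and swap_inf: "prod.swap (inf \<alpha>'' \<beta>'') = inf (prod.swap \<alpha>'') (prod.swap \<beta>'')"
  by (simp_all add: prod_eq_iff)

lemma good_semigroup_swap:
  assumes S: "good_semigroup S" shows "good_semigroup (prod.swap ` S)"
proof -
  have "\<exists>c\<in>S. \<forall>\<beta>\<ge>0. c + \<beta> \<in> S" using S unfolding good_semigroup_def by (elim conjE)
  then obtain c where c: "c \<in> S" "\<And>\<beta>. 0 \<le> \<beta> \<Longrightarrow> c + \<beta> \<in> S" by blast
  have "prod.swap c + \<beta> \<in> prod.swap ` S" if "0 \<le> \<beta>" for \<beta>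
  proof -
    have "c + prod.swap \<beta> \<in> S" using that c(2) zero_le_swap_iff by blast
    then have "prod.swap (c + prod.swap \<beta>) \<in> prod.swap ` S" by blast
    then show ?thesis by (simp add: swap_add)
  qed
  with c(1) have 1: "\<exists>c\<in>prod.swap ` S. \<forall>\<beta>\<ge>0. c + \<beta> \<in> prod.swap ` S" by blast
  \<comment> \<open>Reflection exchanges the two instances of (G2), one for each order of the
    projections.\<close>
  have 2: "\<forall>(p, q) \<in> {(fst, snd), (snd, fst)}. \<forall>\<alpha>\<in>prod.swap ` S. \<forall>\<beta>\<in>prod.swap ` S. p \<alpha> = p \<beta> \<longrightarrow>
        (\<exists>\<delta>\<in>prod.swap ` S. p \<delta> > p \<alpha> \<and> q \<delta> \<ge> min (q \<alpha>) (q \<beta>) \<and>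
           (q \<alpha> \<noteq> q \<beta> \<longrightarrow> q \<delta> = min (q \<alpha>) (q \<beta>)))"
    using S unfolding good_semigroup_def by simp
  have "0 \<in> prod.swap ` S"
    using S unfolding good_semigroup_def by (auto simp: zero_prod_def mem_swap_image_iff)
  then show ?thesis
    using 1 2 S unfolding good_semigroup_def
    by (simp add: zero_le_swap_iff swap_add[symmetric] swap_inf[symmetric])
qed

context symmetric_local_good_semigroup
begin

text \<open>Reflection is an order automorphism fixing \<open>0\<close>, so it carries least
  elements to least elements.\<close>

lemma min_nonzero_swap: "min_nonzero (prod.swap ` S) = prod.swap (min_nonzero S)"
  unfolding min_nonzero_def[of "prod.swap ` S"]
proof (rule Least_equality)
  show "prod.swap (min_nonzero S) \<in> prod.swap ` S - {0}"
    using min_nonzero_mem by (auto simp: prod_eq_iff)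
next
  fix \<alpha> assume "\<alpha> \<in> prod.swap ` S - {0}"
  then obtain \<beta> where "\<beta> \<in> S - {0}" "\<alpha> = prod.swap \<beta>" by (auto simp: prod_eq_iff)
  then show "prod.swap (min_nonzero S) \<le> \<alpha>" using min_nonzero_le swap_le_swap_iff by blast
qed

lemma conductor_swap: "conductor (prod.swap ` S) = prod.swap (conductor S)"
  unfolding conductor_def[of "prod.swap ` S"]
proof (rule Least_equality)
  show "\<forall>\<beta>\<ge>0. prod.swap (conductor S) + \<beta> \<in> prod.swap ` S"
    using conductor_add_mem zero_le_swap_iff by (metis imageI swap_add swap_swap)
next
  fix \<alpha> assume \<alpha>: "\<forall>\<beta>\<ge>0. \<alpha> + \<beta> \<in> prod.swap ` S"
  have "prod.swap \<alpha> + \<beta> \<in> S" if "0 \<le> \<beta>" for \<beta>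
    using \<alpha>[rule_format, of "prod.swap \<beta>"] that zero_le_swap_iff
    by (simp add: mem_swap_image_iff swap_add)
  then show "prod.swap (conductor S) \<le> \<alpha>"
    using conductor_le swap_le_swap_iff by (metis swap_swap)
qed

lemma gam_swap: "gam (prod.swap ` S) = prod.swap (gam S)"
  by (simp add: gam_def conductor_swap swap_diff)

lemma symmetric_local_good_semigroup_swap: "symmetric_local_good_semigroup (prod.swap ` S)"
proof
  show "good_semigroup (prod.swap ` S)" using good by (rule good_semigroup_swap)
  show "local_semigroup (prod.swap ` S)"
    using local by (auto simp: local_semigroup_def prod_eq_iff)
  show "symmetric_semigroup (prod.swap ` S)"
    unfolding symmetric_semigroup_def
  proof (intro allI impI)
    fix \<alpha> :: "int \<times> int"
    obtain a b where \<alpha>: "\<alpha> = (a, b)" by fastforce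
    \<comment> \<open>Reflection exchanges the two arms of \<open>Delta\<close>.\<close>
    have "Delta (prod.swap ` S) (gam (prod.swap ` S) - \<alpha>) = prod.swap ` Delta S (gam S - (b, a))"
      by (rule set_eqI) (auto simp: \<alpha> Delta_def gam_swap mem_swap_image_iff)
    then show "\<alpha> \<in> prod.swap ` S \<longleftrightarrow> Delta (prod.swap ` S) (gam (prod.swap ` S) - \<alpha>) = {}"
      using mem_iff_Delta_empty[of b a] by (simp add: \<alpha> mem_swap_image_iff)
  qed
qed

lemma eS_swap: "eS (prod.swap ` S) = prod.swap ` eS S"
  by (simp add: eS_def min_nonzero_swap image_image swap_add)

lemma Ap_swap: "Ap (prod.swap ` S) = prod.swap ` Ap S"
  by (rule set_eqI) (simp add: Ap_def min_nonzero_swap mem_swap_image_iff swap_diff)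

end

section \<open>Rows as reflected columns, and the transfer of the classification\<close>

lemma V_swap: "V (prod.swap ` S) n = prod.swap ` H S n"
  by (rule set_eqI) (auto simp: V_def H_def mem_swap_image_iff)

lemma finite_swap_image: "finite (prod.swap ` A) \<longleftrightarrow> finite A"
  by (simp add: finite_image_iff)

lemma eventually_in_swap: "eventually_in (prod.swap ` A) (prod.swap ` X) \<longleftrightarrow> eventually_in A X"
  by (simp add: eventually_in_def image_set_diff[symmetric] finite_swap_image)

lemma nonempty_finite_swap: "nonempty_finite (prod.swap ` A) \<longleftrightarrow> nonempty_finite A"
  by (simp add: nonempty_finite_def finite_swap_image)

lemma finite_max_in_swap: "finite_max_in (prod.swap ` A) (prod.swap ` X) \<longleftrightarrow> finite_max_in A X"
  by (simp add: finite_max_in_def nonempty_finite_swap swap_le_swap_iff inj_image_mem_iff)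

theorem theorem4p5:
  fixes S :: "(int \<times> int) set" and n :: int
  assumes "good_semigroup S"
    and "local_semigroup S"
    and "symmetric_semigroup S"
    and "0 \<le> n"
  shows
    "(let n' = fst (gam S) + fst (min_nonzero S) - n in
     ((V S n = {}) \<longleftrightarrow>
        (infinite (V S n') \<and>
         eventually_in (V S n') (eS S))) \<and>
     (finite_max_in (V S n) (eS S) \<longleftrightarrow>
        finite_max_in (V S n') (eS S)) \<and>
     ((\<not> V S n \<subseteq> Ap S \<and> finite_max_in (V S n) (Ap S)) \<longleftrightarrow>
        (\<not> V S n' \<subseteq> Ap S \<and>
         finite_max_in (V S n') (Ap S))) \<and>
     ((V S n \<subseteq> Ap S \<and> nonempty_finite (V S n)) \<longleftrightarrow>
        (infinite (V S n') \<and>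
         eventually_in (V S n') (Ap S) \<and>
         V S n' \<inter> eS S \<noteq> {})) \<and>
     ((V S n \<subseteq> Ap S \<and> infinite (V S n)) \<longleftrightarrow>
        (V S n' \<subseteq> Ap S \<and>
         infinite (V S n'))))
   \<and> (let n' = snd (gam S) + snd (min_nonzero S) - n in
     ((H S n = {}) \<longleftrightarrow>
        (infinite (H S n') \<and>
         eventually_in (H S n') (eS S))) \<and>
     (finite_max_in (H S n) (eS S) \<longleftrightarrow>
        finite_max_in (H S n') (eS S)) \<and>
     ((\<not> H S n \<subseteq> Ap S \<and> finite_max_in (H S n) (Ap S)) \<longleftrightarrow>
        (\<not> H S n' \<subseteq> Ap S \<and>
         finite_max_in (H S n') (Ap S))) \<and>
     ((H S n \<subseteq> Ap S \<and> nonempty_finite (H S n)) \<longleftrightarrow>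
        (infinite (H S n') \<and>
         eventually_in (H S n') (Ap S) \<and>
         H S n' \<inter> eS S \<noteq> {})) \<and>
     ((H S n \<subseteq> Ap S \<and> infinite (H S n)) \<longleftrightarrow>
        (H S n' \<subseteq> Ap S \<and>
         infinite (H S n'))))"
proof -
  interpret symmetric_local_good_semigroup S
    using assms by unfold_locales
  interpret swapped: symmetric_local_good_semigroup "prod.swap ` S"
    by (rule symmetric_local_good_semigroup_swap)
  \<comment> \<open>Rewriting pulls \<open>prod.swap\<close> out of every fibre, and its injectivity
    cancels it from inclusions and intersections; the dual index becomes
    \<open>\<gamma>\<^sub>2 + e\<^sub>2 - n\<close>.\<close>
  note rows = swapped.column_classification[of n,
      unfolded gam_swap min_nonzero_swap fst_swap V_swap eS_swap Ap_swap
        finite_swap_image eventually_in_swap nonempty_finite_swap finite_max_in_swap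
        inj_image_subset_iff[OF inj_swap] image_Int[OF inj_swap, symmetric] image_is_empty]
  show ?thesis
    unfolding Let_def using column_classification[of n] rows by (rule conjI)
qed

end
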